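(* Let $T$ be a forest with vertex set $V(T)$, and let $\Psi(T)$ be the family of all local maximum stable sets of $T$. Then the pair $(V(T),\Psi(T))$ is a greedoid.
   Context: Graphs are finite and simple (undirected, no loops, no multiple edges). A forest is an acyclic graph of order greater than $1$ (it need not be connected). A stable set is a set of pairwise non-adjacent vertices. For a graph $G$, $\Omega(G)$ is the set of all stable sets of $G$ of maximum cardinality (maximum stable sets). For $A\subseteq V(G)$, $N(A)=\{v\in V(G)-A : v \text{ is adjacent to some vertex of } A\}$, and $G[X]$ is the subgraph of $G$ induced by $X\subseteq V(G)$. A set $A\subseteq V(G)$ is a local maximum stable set of $G$ if $A\in\Omega(G[A\cup N(A)])$; $\Psi(G)$ denotes the set of all local maximum stable sets of $G$. (The empty set is a local maximum stable set.) A greedoid is a pair $(E,\mathcal{F})$, where $\mathcal{F}\subseteq 2^{E}$ is a set system satisfying: (Accessibility) for every non-empty $X\in\mathcal{F}$ there is an $x\in X$ such that $X-\{x\}\in\mathcal{F}$; (Exchange) for all $X,Y\in\mathcal{F}$ with $|X|=|Y|+1$, there is an $x\in X-Y$ such that $Y\cup\{x\}\in\mathcal{F}$. *)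

theory Defs
  imports "Graph_Theory.Digraph_Component"
begin

text \<open>
  Finite simple graphs are rendered by the locale \<^locale>\<open>graph\<close>: finite symmetric digraphs
  without loops or parallel arcs, an undirected edge being a pair of opposite arcs.
\<close>

text \<open>
  In a symmetric digraph every edge gives a directed cycle of length two, so the library's
  predicate \<^const>\<open>forest\<close> holds only for edgeless graphs here. The cycles of the underlying
  undirected simple graph are exactly the directed cycles of length at least three.
\<close>
definition simple_forest :: "('a, 'b) pre_digraph \<Rightarrow> bool" where
  "simple_forest G \<longleftrightarrow>
     graph G \<and> card (verts G) > 1 \<and> \<not> (\<exists>p. pre_digraph.cycle G p \<and> length p \<ge> 3)"

definition stable :: "('a, 'b) pre_digraph \<Rightarrow> 'a set \<Rightarrow> bool" where
  "stable G S \<longleftrightarrow> S \<subseteq> verts G \<and> (\<forall>u\<in>S. \<forall>v\<in>S. \<not> u \<rightarrow>\<^bsub>G\<^esub> v)"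

definition maximum_stable_sets :: "('a, 'b) pre_digraph \<Rightarrow> 'a set set"  (\<open>\<Omega>\<close>) where
  "\<Omega> G = {S. stable G S \<and> (\<forall>S'. stable G S' \<longrightarrow> card S' \<le> card S)}"

definition neighborhood :: "('a, 'b) pre_digraph \<Rightarrow> 'a set \<Rightarrow> 'a set" where
  "neighborhood G A = {v \<in> verts G - A. \<exists>u\<in>A. v \<rightarrow>\<^bsub>G\<^esub> u}"

text \<open>
  The vertex set of \<^term>\<open>G \<restriction> X\<close> is \<^term>\<open>X\<close> even if \<^term>\<open>X\<close> is not contained in
  \<^term>\<open>verts G\<close>, so \<^prop>\<open>A \<subseteq> verts G\<close> has to be required explicitly.
\<close>
definition local_maximum_stable_sets :: "('a, 'b) pre_digraph \<Rightarrow> 'a set set"  (\<open>\<Psi>\<close>) where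
  "\<Psi> G = {A. A \<subseteq> verts G \<and> A \<in> \<Omega> (G \<restriction> (A \<union> neighborhood G A))}"

locale greedoid =
  fixes E :: "'a set" and F :: "'a set set"
  assumes finite_ground: "finite E"
    and set_system: "F \<subseteq> Pow E"
    and accessibility: "\<And>X. X \<in> F \<Longrightarrow> X \<noteq> {} \<Longrightarrow> \<exists>x\<in>X. X - {x} \<in> F"
    and exchange:
      "\<And>X Y. X \<in> F \<Longrightarrow> Y \<in> F \<Longrightarrow> card X = card Y + 1 \<Longrightarrow> \<exists>x\<in>X - Y. Y \<union> {x} \<in> F"

end

theory Submission
  imports Defs
begin

text \<open>
  The main tool is the Hall-type condition of lemma \<open>card_le_of_neighbors_in\<close>: if \<open>A\<close> is a local maximum stable set, then a stable set \<open>Q\<close> of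
  neighbours of \<open>A\<close> is at most as large as any part \<open>P\<close> of \<open>A\<close> that contains all neighbours of
  \<open>Q\<close> in \<open>A\<close>, because replacing \<open>P\<close> by \<open>Q\<close> leaves a stable set inside the closed neighbourhood
  of \<open>A\<close>.

  Both greedoid axioms come from one statement about a forest, lemma \<open>exchange_outside\<close>: if \<open>X\<close>
  and \<open>Y\<close> are local maximum stable sets and \<open>X\<close> is not contained in the closed neighbourhood of
  \<open>Y\<close>, then some \<open>x \<in> X - Y\<close> can be added to \<open>Y\<close>. The idea is as follows. A vertex \<open>x\<close> outside
  the closed neighbourhood can be added as soon as it contributes at most one new neighbour \<open>w\<close>,
  since a stable set contains at most one of the adjacent vertices \<open>x\<close> and \<open>w\<close>. If no
  \<open>x\<close> qualifies, then all vertices of \<open>Z\<close>, the part of \<open>X\<close> outside the closed neighbourhood of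
  \<open>Y\<close>, have at least two new neighbours; in a forest this forces strictly more new neighbours than
  vertices in \<open>Z\<close> (lemma \<open>card_less_of_two_neighbors\<close>). Two uses of the Hall-type condition, one for \<open>Y\<close> and one for \<open>X\<close>, show that
  there are at most as many. For the condition to apply, the set of new neighbours has to be stable,
  and this is achieved by working in a single colour class of a proper two-colouring of the forest.

  If \<open>card X > card Y\<close>, then \<open>X\<close> does not fit into the closed neighbourhood of \<open>Y\<close> because \<open>Y\<close> is
  a maximum stable set there: this gives the exchange axiom. If \<open>Y \<subset> X\<close>, then a vertex of \<open>X - Y\<close>
  is no neighbour of \<open>Y\<close> because \<open>X\<close> is stable: so an inclusion-maximal local maximum stable
  proper subset \<open>Y\<close> of a nonempty \<open>X\<close>, which exists because the empty set is a candidate, arises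
  from \<open>X\<close> by deleting a single vertex. This gives accessibility.
\<close>

section \<open>Local maximum stable sets in a graph\<close>

context graph
begin

lemma adj_sym: "u \<rightarrow>\<^bsub>G\<^esub> v \<Longrightarrow> v \<rightarrow>\<^bsub>G\<^esub> u"
  by (rule arcs_ends_symmetric[OF sym_arcs])

lemma finite_stable: "stable G S \<Longrightarrow> finite S"
  unfolding stable_def using finite_verts finite_subset by blast

lemma stable_induce_subgraph_iff:
  assumes "H \<subseteq> verts G"
  shows "stable (G \<restriction> H) S \<longleftrightarrow> stable G S \<and> S \<subseteq> H"
proof -
  have "u \<rightarrow>\<^bsub>G \<restriction> H\<^esub> v \<longleftrightarrow> u \<rightarrow>\<^bsub>G\<^esub> v" if "u \<in> H" "v \<in> H" for u v
    using that by (auto simp: arcs_ends_conv)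
  then show ?thesis
    using assms unfolding stable_def induce_subgraph_verts by (meson subset_iff)
qed

lemma local_maximum_stable_sets_iff:
  "A \<in> \<Psi> G \<longleftrightarrow> stable G A \<and>
     (\<forall>S. stable G S \<longrightarrow> S \<subseteq> A \<union> neighborhood G A \<longrightarrow> card S \<le> card A)"
proof (cases "A \<subseteq> verts G")
  case True
  then have "A \<union> neighborhood G A \<subseteq> verts G"
    by (auto simp: neighborhood_def)
  then show ?thesis
    using True
    by (auto simp: local_maximum_stable_sets_def maximum_stable_sets_def
        stable_induce_subgraph_iff)
next
  case False
  then show ?thesis
    by (auto simp: local_maximum_stable_sets_def stable_def)
qed

lemma local_maximum_stable: "A \<in> \<Psi> G \<Longrightarrow> stable G A"
  unfolding local_maximum_stable_sets_iff by (rule conjunct1)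

lemma local_maximum_card_le:
  assumes "A \<in> \<Psi> G" "stable G S" "S \<subseteq> A \<union> neighborhood G A"
  shows "card S \<le> card A"
  using assms unfolding local_maximum_stable_sets_iff by blast

lemma empty_local_maximum: "{} \<in> \<Psi> G"
  by (auto simp: local_maximum_stable_sets_iff stable_def neighborhood_def)

text \<open>
  The disjoint union \<open>(A - P) \<union> Q\<close> is stable and lies in the closed neighbourhood of \<open>A\<close>, so it is at most
  as large as \<open>A\<close>.
\<close>
lemma card_le_of_neighbors_in:
  assumes A: "A \<in> \<Psi> G" and P: "P \<subseteq> A"
    and Q: "stable G Q" "Q \<subseteq> neighborhood G A"
    and nbrs: "\<And>q a. q \<in> Q \<Longrightarrow> a \<in> A \<Longrightarrow> q \<rightarrow>\<^bsub>G\<^esub> a \<Longrightarrow> a \<in> P"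
  shows "card Q \<le> card P"
proof -
  have stA: "stable G A"
    using A by (rule local_maximum_stable)
  have fin: "finite A" "finite P" "finite Q"
    using stA Q(1) P finite_stable finite_subset by blast+
  have "stable G ((A - P) \<union> Q)"
    using stA Q(1) nbrs unfolding stable_def by (blast intro: adj_sym)
  then have "card ((A - P) \<union> Q) \<le> card A"
    using Q(2) by (intro local_maximum_card_le[OF A]) auto
  moreover have "card ((A - P) \<union> Q) = card (A - P) + card Q"
    using Q(2) fin by (intro card_Un_disjoint) (auto simp: neighborhood_def)
  moreover have "card (A - P) = card A - card P" "card P \<le> card A"
    using P fin by (auto simp: card_Diff_subset card_mono)
  ultimately show ?thesis by linarith
qed

text \<open>
  In a stable set inside the new closed neighbourhood, at most one of the adjacent vertices
  \<open>x\<close> and \<open>w\<close> occurs, and everything else lies in the old closed neighbourhood.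
\<close>
lemma insert_local_maximum:
  assumes Y: "Y \<in> \<Psi> G"
    and x: "x \<in> verts G" "x \<notin> Y \<union> neighborhood G Y"
    and new: "\<And>v. x \<rightarrow>\<^bsub>G\<^esub> v \<Longrightarrow> v \<notin> neighborhood G Y \<Longrightarrow> v = w"
  shows "Y \<union> {x} \<in> \<Psi> G"
proof -
  have stY: "stable G Y"
    using Y by (rule local_maximum_stable)
  have "stable G (Y \<union> {x})"
    using stY x adj_not_same adj_sym unfolding stable_def neighborhood_def by blast
  moreover have "card S \<le> card (Y \<union> {x})"
    if S: "stable G S" "S \<subseteq> (Y \<union> {x}) \<union> neighborhood G (Y \<union> {x})" for S
  proof -
    define R where "R = S \<inter> (Y \<union> neighborhood G Y)"
    have finS: "finite S" using S(1) by (rule finite_stable)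
    have outside: "v = x \<or> v = w \<and> x \<rightarrow>\<^bsub>G\<^esub> v" if "v \<in> S - R" for v
      using that S(2) new adj_sym unfolding R_def neighborhood_def by blast
    have "\<exists>y. S - R \<subseteq> {y}"
    proof (cases "x \<in> S")
      case True
      then have "S - R \<subseteq> {x}"
        using outside S(1) unfolding stable_def by blast
      then show ?thesis ..
    next
      case False
      then have "S - R \<subseteq> {w}"
        using outside by blast
      then show ?thesis ..
    qed
    then have "card (S - R) \<le> 1"
      by (metis card_mono finite.emptyI finite_insert is_singletonI is_singleton_altdef)
    moreover have "card R \<le> card Y"
      using S(1) by (intro local_maximum_card_le[OF Y]) (auto simp: R_def stable_def)
    moreover have "card S = card R + card (S - R)"
      using finS by (metis R_def Int_lower1 card_Diff_subset card_mono
          finite_subset le_add_diff_inverse)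
    moreover have "card (Y \<union> {x}) = Suc (card Y)"
      using x finite_stable[OF stY] by simp
    ultimately show ?thesis by linarith
  qed
  ultimately show ?thesis
    by (auto simp: local_maximum_stable_sets_iff)
qed

end

section \<open>Counting and colouring in forests\<close>

locale acyclic_graph = graph +
  assumes no_long_cycle: "cycle p \<Longrightarrow> length p < 3"
begin

text \<open>
  Otherwise the first vertex of a longest path inside \<open>U\<close> has a neighbour in \<open>U\<close> other than the
  second vertex. It lies on the path by maximality and closes a cycle.
\<close>
lemma obtain_leaf:
  assumes U: "U \<subseteq> verts G" "U \<noteq> {}"
  obtains u x where "u \<in> U" "\<And>v. v \<in> U \<Longrightarrow> u \<rightarrow>\<^bsub>G\<^esub> v \<Longrightarrow> v = x"
proof -
  have "\<exists>u\<in>U. \<exists>x. \<forall>v\<in>U. u \<rightarrow>\<^bsub>G\<^esub> v \<longrightarrow> v = x"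
  proof (rule ccontr)
    assume "\<not> ?thesis"
    then have two: "\<exists>v\<in>U. u \<rightarrow>\<^bsub>G\<^esub> v \<and> v \<noteq> x" if "u \<in> U" for u x
      using that by blast
    define paths where
      "paths = {(u, p, v). apath u p v \<and> set (awalk_verts u p) \<subseteq> U}"
    have "finite paths"
      unfolding paths_def by (rule finite_subset[OF _ apaths_finite_triple]) auto
    moreover obtain u0 where "u0 \<in> U" using U by blast
    then have "(u0, [], u0) \<in> paths"
      using U by (auto simp: paths_def apath_Nil_iff)
    ultimately obtain u p v where "(u, p, v) \<in> paths"
      and longest: "\<And>t. t \<in> paths \<Longrightarrow> length (fst (snd t)) \<le> length p"
      using obtains_MAX[of paths "\<lambda>t. length (fst (snd t))"]
      by (metis (no_types, lifting) Max_ge empty_iff finite_imageI fst_conv imageI prod_cases3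
          snd_conv)
    then have path: "apath u p v" and in_U: "set (awalk_verts u p) \<subseteq> U"
      by (auto simp: paths_def)
    then have walk: "awalk u p v" and dist: "distinct (awalk_verts u p)"
      by (auto simp: apath_def)
    have "u \<in> U"
      using in_U hd_in_awalk_verts(1)[OF walk] by blast
    \<comment> \<open>For \<open>p = []\<close> the vertex \<open>head G (hd p)\<close> is arbitrary, and avoiding it does no harm. Otherwise
      it is the second vertex of the path, and avoiding it makes the cycle longer than a single edge
      traversed back and forth.\<close>
    then obtain w where w: "w \<in> U" "u \<rightarrow>\<^bsub>G\<^esub> w" "w \<noteq> head G (hd p)"
      using two by blast
    obtain e where e: "e \<in> arcs G" "tail G e = w" "head G e = u"
      using adj_sym[OF w(2)] by blast
    have "w \<in> set (awalk_verts u p)"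
    proof (rule ccontr)
      assume "w \<notin> set (awalk_verts u p)"
      then have "(w, e # p, v) \<in> paths"
        using e w(1) walk dist in_U by (auto simp: paths_def apath_def awalk_Cons_iff)
      then show False using longest by fastforce
    qed
    then obtain q r where qr: "p = q @ r" "awalk u q w"
      using awalk_decomp[OF walk] by blast
    have "w \<noteq> u" using w(2) adj_not_same by blast
    have "length q \<ge> 2"
    proof (rule ccontr)
      assume "\<not> length q \<ge> 2"
      then consider "q = []" | a where "q = [a]"
        by (cases q rule: remdups_adj.cases) auto
      then show False
        using qr \<open>w \<noteq> u\<close> w(3) by cases (auto simp: awalk_simps)
    qed
    moreover have "distinct (awalk_verts u q)"
      using dist walk qr(1) by (auto simp: awalk_verts_append)
    then have "cycle (e # q)"
      unfolding cycle_def using e qr(2) by (auto simp: awalk_Cons_iff)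
    ultimately show False
      using no_long_cycle[of "e # q"] by simp
  qed
  then show thesis using that by blast
qed

text \<open>
  By induction: delete a leaf, colour the rest, and give the leaf the colour that its neighbour does not have.
\<close>
lemma obtain_two_coloring:
  obtains c :: "'a \<Rightarrow> bool" where "\<And>u v. u \<rightarrow>\<^bsub>G\<^esub> v \<Longrightarrow> c u \<noteq> c v"
proof -
  have "\<exists>c. \<forall>u\<in>U. \<forall>v\<in>U. u \<rightarrow>\<^bsub>G\<^esub> v \<longrightarrow> c u \<noteq> (c v :: bool)" if "U \<subseteq> verts G" for U
    using finite_subset[OF that finite_verts] that
  proof (induction U rule: finite_psubset_induct)
    case (psubset U)
    show ?case
    proof (cases "U = {}")
      case False
      then obtain l x where l: "l \<in> U" "\<And>v. v \<in> U \<Longrightarrow> l \<rightarrow>\<^bsub>G\<^esub> v \<Longrightarrow> v = x"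
        using obtain_leaf psubset.prems by blast
      then have sub: "U - {l} \<subset> U" "U - {l} \<subseteq> verts G"
        using psubset.prems by auto
      obtain c :: "'a \<Rightarrow> bool"
        where "\<forall>u\<in>U - {l}. \<forall>v\<in>U - {l}. u \<rightarrow>\<^bsub>G\<^esub> v \<longrightarrow> c u \<noteq> c v"
        using psubset.IH[OF sub] by (elim exE)
      then have c: "c u \<noteq> c v"
        if "u \<in> U - {l}" "v \<in> U - {l}" "u \<rightarrow>\<^bsub>G\<^esub> v" for u v
        using that by blast
      \<comment> \<open>No harm is done if \<open>l\<close> has no neighbour in \<open>U\<close> and \<open>x\<close> is therefore arbitrary.\<close>
      have "(c(l := \<not> c x)) u \<noteq> (c(l := \<not> c x)) v" if "u \<in> U" "v \<in> U" "u \<rightarrow>\<^bsub>G\<^esub> v" for u v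
        using that c[of u v] l(2)[of u] l(2)[of v] adj_sym[of u v] adj_not_same[of l]
        by (auto simp: fun_upd_def)
      then show ?thesis by (intro exI[of _ "c(l := \<not> c x)"] ballI impI)
    qed simp
  qed
  from this[OF subset_refl] obtain c :: "'a \<Rightarrow> bool"
    where "\<forall>u\<in>verts G. \<forall>v\<in>verts G. u \<rightarrow>\<^bsub>G\<^esub> v \<longrightarrow> c u \<noteq> c v" ..
  then have "c u \<noteq> c v" if "u \<rightarrow>\<^bsub>G\<^esub> v" for u v
    using that adj_in_verts[OF that] by simp
  then show thesis by (rule that)
qed

text \<open>
  The edges between \<open>Z\<close> and \<open>W\<close> form a forest with at least \<open>2 * card Z\<close> edges, hence with more
  than \<open>2 * card Z\<close> vertices. The proof avoids counting edges: a leaf of \<open>Z \<union> W\<close> cannot belong to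
  \<open>Z\<close>, and deleting it together with its possible neighbour in \<open>Z\<close> preserves the hypothesis.
\<close>
lemma card_less_of_two_neighbors:
  assumes "Z \<subseteq> verts G" "W \<subseteq> verts G" "Z \<inter> W = {}" "Z \<noteq> {}"
    and "\<And>z x. z \<in> Z \<Longrightarrow> \<exists>w\<in>W. z \<rightarrow>\<^bsub>G\<^esub> w \<and> w \<noteq> x"
  shows "card Z < card W"
  using finite_subset[OF assms(2) finite_verts] assms
proof (induction W arbitrary: Z rule: finite_psubset_induct)
  case (psubset W)
  note two = psubset.prems(5)
  have finZ: "finite Z" using psubset.prems(1) finite_verts finite_subset by blast
  obtain l x where l: "l \<in> Z \<union> W" "\<And>v. v \<in> Z \<union> W \<Longrightarrow> l \<rightarrow>\<^bsub>G\<^esub> v \<Longrightarrow> v = x"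
    using obtain_leaf[of "Z \<union> W"] psubset.prems by blast
  have "l \<in> W" using l two by blast
  show ?case
  proof (cases "Z \<subseteq> {x}")
    case True
    then have "Z = {x}" using psubset.prems(4) by blast
    then obtain w where w: "w \<in> W" "w \<noteq> l" using two by blast
    have "card {l, w} \<le> card W"
      using \<open>l \<in> W\<close> w psubset.hyps(1) by (intro card_mono) auto
    then show ?thesis using w \<open>Z = {x}\<close> by simp
  next
    case False
    have "card (Z - {x}) < card (W - {l})"
    proof (rule psubset.IH)
      show "W - {l} \<subset> W" using \<open>l \<in> W\<close> by blast
      show "\<exists>w\<in>W - {l}. z \<rightarrow>\<^bsub>G\<^esub> w \<and> w \<noteq> y" if "z \<in> Z - {x}" for z y
      proof -
        have "\<not> z \<rightarrow>\<^bsub>G\<^esub> l" using that l(2) adj_sym by blast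
        then show ?thesis using that two[of z y] by blast
      qed
    qed (use psubset.prems False in auto)
    moreover have "card W = Suc (card (W - {l}))"
      using \<open>l \<in> W\<close> psubset.hyps(1) by (metis card_Suc_Diff1)
    moreover have "card Z \<le> Suc (card (Z - {x}))"
      by (metis card.insert_remove card_mono finZ finite_insert finite_Diff insert_Diff_single
          subset_insertI)
    ultimately show ?thesis by linarith
  qed
qed

section \<open>Exchange in forests\<close>

text \<open>
  Suppose that no \<open>x\<close> works, and restrict to one colour class throughout. Its vertices in \<open>X\<close>
  outside the closed neighbourhood of \<open>Y\<close> (the set \<open>Z\<close>) have more than \<open>card Z\<close> neighbours \<open>W\<close>
  outside \<open>neighborhood G Y\<close>. To bound \<open>card W\<close> by local maximality of \<open>X\<close>, the other possible
  neighbours \<open>X1\<close> of \<open>W\<close> in this colour class of \<open>X\<close> have to be given up as well. They are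
  compensated for by their neighbours \<open>Y1\<close> in \<open>Y\<close>, whose number is at least \<open>card X1\<close> by local
  maximality of \<open>Y\<close>.
\<close>
lemma exchange_outside:
  assumes X: "X \<in> \<Psi> G" and Y: "Y \<in> \<Psi> G"
    and not_sub: "\<not> X \<subseteq> Y \<union> neighborhood G Y"
  shows "\<exists>x\<in>X - Y. Y \<union> {x} \<in> \<Psi> G"
proof (rule ccontr)
  assume none: "\<not> ?thesis"
  have stX: "stable G X" and stY: "stable G Y"
    using X Y local_maximum_stable by auto
  have VX: "X \<subseteq> verts G" and VY: "Y \<subseteq> verts G"
    using stX stY by (auto simp: stable_def)
  have two: "\<exists>v. x \<rightarrow>\<^bsub>G\<^esub> v \<and> v \<notin> neighborhood G Y \<and> v \<noteq> w"
    if "x \<in> X" "x \<notin> Y \<union> neighborhood G Y" for x w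
    using insert_local_maximum[OF Y, of x w] none that VX by blast
  obtain c :: "'a \<Rightarrow> bool" where c: "\<And>u v. u \<rightarrow>\<^bsub>G\<^esub> v \<Longrightarrow> c u \<noteq> c v"
    using obtain_two_coloring by blast
  obtain z0 where z0: "z0 \<in> X" "z0 \<notin> Y \<union> neighborhood G Y"
    using not_sub by blast
  define Z where "Z = {z \<in> X. z \<notin> Y \<union> neighborhood G Y \<and> c z = c z0}"
  define W where "W = {w. w \<notin> neighborhood G Y \<and> (\<exists>z\<in>Z. z \<rightarrow>\<^bsub>G\<^esub> w)}"
  define X1 where "X1 = {x \<in> X \<inter> neighborhood G Y. c x = c z0}"
  define Y1 where "Y1 = {y \<in> Y. \<exists>x\<in>X1. x \<rightarrow>\<^bsub>G\<^esub> y}"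
  have VW: "W \<subseteq> verts G" unfolding W_def using adj_in_verts by blast
  have cW: "c w \<noteq> c z0" if "w \<in> W" for w
    using that c unfolding W_def Z_def by blast
  have cY1: "c y \<noteq> c z0" if "y \<in> Y1" for y
    using that c unfolding Y1_def X1_def by blast
  have WY: "W \<inter> Y = {}"
    using VX unfolding W_def Z_def neighborhood_def by blast
  have fin: "finite Z" "finite W" "finite X1" "finite Y1"
    using VW finite_verts finite_subset finite_stable[OF stX] finite_stable[OF stY]
    by (auto simp: Z_def X1_def Y1_def intro: finite_subset)
  have "card Z < card W"
  proof (rule card_less_of_two_neighbors)
    show "Z \<subseteq> verts G" "Z \<noteq> {}" using VX z0 by (auto simp: Z_def)
    show "Z \<inter> W = {}" using cW by (auto simp: Z_def)
    show "\<exists>w\<in>W. z \<rightarrow>\<^bsub>G\<^esub> w \<and> w \<noteq> x" if "z \<in> Z" for z x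
      using that two[of z x] by (auto simp: Z_def W_def)
  qed (fact VW)
  moreover have "card X1 \<le> card Y1"
  proof (rule card_le_of_neighbors_in[OF Y])
    show "stable G X1" using stX by (auto simp: X1_def stable_def)
  qed (auto simp: X1_def Y1_def)
  moreover have "card (Y1 \<union> W) \<le> card (X1 \<union> Z)"
  proof (rule card_le_of_neighbors_in[OF X])
    show "X1 \<union> Z \<subseteq> X" by (auto simp: X1_def Z_def)
    show "stable G (Y1 \<union> W)"
    proof -
      have "\<not> u \<rightarrow>\<^bsub>G\<^esub> v" if "u \<in> Y1 \<union> W" "v \<in> Y1 \<union> W" for u v
        using that c[of u v] cW cY1 by blast
      then show ?thesis
        using VY VW by (auto simp: stable_def Y1_def)
    qed
    show "Y1 \<union> W \<subseteq> neighborhood G X"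
    proof
      fix v assume v: "v \<in> Y1 \<union> W"
      then obtain x where "x \<in> X" "x \<rightarrow>\<^bsub>G\<^esub> v"
        unfolding Y1_def X1_def W_def Z_def by blast
      then show "v \<in> neighborhood G X"
        using stX adj_in_verts adj_sym unfolding neighborhood_def stable_def by blast
    qed
    show "x \<in> X1 \<union> Z" if "v \<in> Y1 \<union> W" "x \<in> X" "v \<rightarrow>\<^bsub>G\<^esub> x" for v x
    proof (rule ccontr)
      assume "x \<notin> X1 \<union> Z"
      moreover have "c x = c z0"
        using that c[of v x] cW cY1 by blast
      ultimately have "x \<in> Y" using that(2) by (auto simp: X1_def Z_def)
      then show False
        using that stY VW WY unfolding Y1_def W_def neighborhood_def stable_def by blast
    qed
  qed
  moreover have "card (Y1 \<union> W) = card Y1 + card W"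
    using fin WY by (intro card_Un_disjoint) (auto simp: Y1_def)
  moreover have "card (X1 \<union> Z) \<le> card X1 + card Z"
    by (rule card_Un_le)
  ultimately show False by linarith
qed

lemma local_maximum_exchange:
  assumes X: "X \<in> \<Psi> G" and Y: "Y \<in> \<Psi> G" and "card Y < card X"
  shows "\<exists>x\<in>X - Y. Y \<union> {x} \<in> \<Psi> G"
proof (rule exchange_outside[OF X Y])
  show "\<not> X \<subseteq> Y \<union> neighborhood G Y"
    using local_maximum_card_le[OF Y local_maximum_stable[OF X]] \<open>card Y < card X\<close> by linarith
qed

lemma local_maximum_accessible:
  assumes X: "X \<in> \<Psi> G" and "X \<noteq> {}"
  shows "\<exists>x\<in>X. X - {x} \<in> \<Psi> G"
proof -
  have stX: "stable G X"
    using X by (rule local_maximum_stable)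
  define C where "C = {Y \<in> \<Psi> G. Y \<subset> X}"
  have "finite C"
    by (rule finite_subset[of _ "Pow X"]) (use finite_stable[OF stX] in \<open>auto simp: C_def\<close>)
  moreover have "{} \<in> C"
    using empty_local_maximum \<open>X \<noteq> {}\<close> by (auto simp: C_def)
  ultimately obtain Y where "Y \<in> C" and maximal: "\<And>Y'. Y' \<in> C \<Longrightarrow> Y \<subseteq> Y' \<Longrightarrow> Y = Y'"
    using finite_has_maximal[of C] by blast
  then have Y: "Y \<in> \<Psi> G" "Y \<subset> X" by (auto simp: C_def)
  have "\<not> X \<subseteq> Y \<union> neighborhood G Y"
    using Y(2) stX unfolding neighborhood_def stable_def by blast
  then obtain x where x: "x \<in> X - Y" "Y \<union> {x} \<in> \<Psi> G"
    using exchange_outside[OF X Y(1)] by blast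
  then have "Y \<union> {x} = X"
    using maximal[of "Y \<union> {x}"] Y(2) by (auto simp: C_def)
  then have "X - {x} = Y" using x(1) by blast
  then show ?thesis using x(1) Y(1) by blast
qed

end

theorem theorem1p3:
  fixes T :: "('a, 'b) pre_digraph"
  assumes "simple_forest T"
  shows "greedoid (verts T) (\<Psi> T)"
proof -
  interpret graph T
    using assms by (simp add: simple_forest_def)
  interpret acyclic_graph T
    by unfold_locales (use assms in \<open>auto simp: simple_forest_def not_le\<close>)
  show ?thesis
  proof
    show "\<Psi> T \<subseteq> Pow (verts T)"
      by (auto simp: local_maximum_stable_sets_def)
    show "\<exists>x\<in>X. X - {x} \<in> \<Psi> T" if "X \<in> \<Psi> T" "X \<noteq> {}" for X
      using that by (rule local_maximum_accessible)
    show "\<exists>x\<in>X - Y. Y \<union> {x} \<in> \<Psi> T"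
      if "X \<in> \<Psi> T" "Y \<in> \<Psi> T" "card X = card Y + 1" for X Y
      using that by (intro local_maximum_exchange) simp_all
  qed (rule finite_verts)
qed

end
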